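(* Let $T>0$, let $\sigma>1$, and let $\psi>0$ be a real number representing an angle in $S^1=\mathbb{R}/2\pi\mathbb{Z}$. Let $$\mathbf{\Lambda}=\begin{bmatrix}\sigma&0&0&0\\0&\sigma^{-1}&0&0\\0&0&\cos\psi&\sin\psi\\0&0&-\sin\psi&\cos\psi\end{bmatrix}$$ act on $\mathbb{R}^4$ with coordinates $\mathbf{x}=(q_1,p_1,q_2,p_2)$. Set $$\tilde\lambda=\tfrac1T\ln\sigma>0,\qquad \tilde\nu=\tfrac1T\psi>0,$$ and define the effective quadratic Hamiltonian $$\tilde H_2(q_1,p_1,q_2,p_2)=\tilde\lambda\, q_1p_1+\tfrac12\tilde\nu\,(q_2^2+p_2^2).$$ Then the discrete map $\mathbf{x}\mapsto\mathbf{\Lambda}\mathbf{x}$ is identical to the time-$T$ map of the linear Hamilton's canonical equations generated by $\tilde H_2$.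
   Context: The coordinates $(q_1,p_1,q_2,p_2)$ are canonical, with conjugate pairs $(q_1,p_1)$ and $(q_2,p_2)$. Hamilton's canonical equations generated by a function $H(q_1,p_1,q_2,p_2)$ are $\dot q_i=\partial H/\partial p_i$, $\dot p_i=-\partial H/\partial q_i$ for $i=1,2$. The time-$T$ map of such a system is the map $\mathbf{x}(0)\mapsto\mathbf{x}(T)$ sending an initial condition to the value at time $T$ of the solution starting from it at time $0$. *)

theory Defs
  imports "HOL-Analysis.Analysis"
begin

text \<open>
  The canonical coordinates \<open>(q\<^sub>1, p\<^sub>1, q\<^sub>2, p\<^sub>2)\<close> of a point \<open>x :: real ^ 4\<close> are
  \<open>(x $ 1, x $ 2, x $ 3, x $ 4)\<close>. The index \<open>4 :: 4\<close> is equal to \<open>0\<close>, but \<open>vector\<close> still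
  enumerates the components in the order \<open>1, 2, 3, 4\<close>:
\<close>

lemma vector_4:
  fixes a b c d :: "'a::zero"
  shows "(vector [a, b, c, d] :: 'a ^ 4) $ 1 = a"
    and "(vector [a, b, c, d] :: 'a ^ 4) $ 2 = b"
    and "(vector [a, b, c, d] :: 'a ^ 4) $ 3 = c"
    and "(vector [a, b, c, d] :: 'a ^ 4) $ 4 = d"
  by (simp_all add: vector_def)

text \<open>Since \<open>deriv\<close> is total, this is meaningful only where the partial derivative exists.\<close>

definition partial_deriv :: "(real ^ 'n \<Rightarrow> real) \<Rightarrow> 'n \<Rightarrow> real ^ 'n \<Rightarrow> real"
  where "partial_deriv H i x = deriv (\<lambda>s. H (x + s *\<^sub>R axis i 1)) 0"

definition hamiltonian_field :: "(real ^ 4 \<Rightarrow> real) \<Rightarrow> real ^ 4 \<Rightarrow> real ^ 4"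
  where "hamiltonian_field H x =
    vector [partial_deriv H 2 x, - partial_deriv H 1 x,
            partial_deriv H 4 x, - partial_deriv H 3 x]"

definition solves_hamilton :: "(real ^ 4 \<Rightarrow> real) \<Rightarrow> real \<Rightarrow> (real \<Rightarrow> real ^ 4) \<Rightarrow> bool"
  where "solves_hamilton H T x \<longleftrightarrow>
    (\<forall>t\<in>{0..T}. (x has_vector_derivative hamiltonian_field H (x t)) (at t within {0..T}))"

text \<open>
  \<open>\<Phi>\<close> is the time-\<open>T\<close> map: every initial condition \<open>x\<^sub>0\<close> has one and only one solution on
  \<open>{0..T}\<close> (solutions being identified when they agree on that interval), and \<open>\<Phi> x\<^sub>0\<close> is its
  value at time \<open>T\<close>. For \<open>T \<ge> 0\<close> there is at most one such \<open>\<Phi>\<close>.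
\<close>

definition is_time_map :: "(real ^ 4 \<Rightarrow> real) \<Rightarrow> real \<Rightarrow> (real ^ 4 \<Rightarrow> real ^ 4) \<Rightarrow> bool"
  where "is_time_map H T \<Phi> \<longleftrightarrow>
    (\<forall>x\<^sub>0. \<exists>x. solves_hamilton H T x \<and> x 0 = x\<^sub>0 \<and> x T = \<Phi> x\<^sub>0 \<and>
      (\<forall>y. solves_hamilton H T y \<and> y 0 = x\<^sub>0 \<longrightarrow> (\<forall>t\<in>{0..T}. y t = x t)))"

definition Lambda_mat :: "real \<Rightarrow> real \<Rightarrow> real ^ 4 ^ 4"
  where "Lambda_mat \<sigma> \<psi> = vector
    [vector [\<sigma>, 0, 0, 0],
     vector [0, inverse \<sigma>, 0, 0],
     vector [0, 0, cos \<psi>, sin \<psi>],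
     vector [0, 0, - sin \<psi>, cos \<psi>]]"

definition eff_hamiltonian :: "real \<Rightarrow> real \<Rightarrow> real ^ 4 \<Rightarrow> real"
  where "eff_hamiltonian lam nu x =
    lam * (x $ 1) * (x $ 2) + (1/2) * nu * ((x $ 3)\<^sup>2 + (x $ 4)\<^sup>2)"

end

theory Submission
  imports Defs
begin

text \<open>
  The canonical equations decouple into \<open>q\<^sub>1' = lam q\<^sub>1\<close>, \<open>p\<^sub>1' = - lam p\<^sub>1\<close> and a harmonic oscillator
  in \<open>(q\<^sub>2, p\<^sub>2)\<close>, with flow \<open>Lambda_mat (exp (lam t)) (nu t)\<close>; at \<open>t = T\<close> the exponents are
  \<open>ln \<sigma>\<close> and \<open>\<psi>\<close>. For uniqueness, the difference of two solutions with the same initial value is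
  again a solution, and \<open>exp (- lam t) q\<^sub>1\<close>, \<open>exp (lam t) p\<^sub>1\<close> and \<open>q\<^sub>2\<^sup>2 + p\<^sub>2\<^sup>2\<close> are conserved.
\<close>

text \<open>The basis vectors of \<open>real ^ 'n\<close> are the \<open>axis i 1\<close>, and the
  inner product with one of them picks out a coordinate.\<close>

lemma has_vector_derivative_vec_iff:
  fixes f :: "real \<Rightarrow> real ^ 'n"
  shows "(f has_vector_derivative f') (at t within S) \<longleftrightarrow>
    (\<forall>i. ((\<lambda>s. f s $ i) has_real_derivative f' $ i) (at t within S))"
  unfolding has_vector_derivative_def has_field_derivative_def
  by (subst has_derivative_componentwise_within)
    (auto simp: Basis_vec_def inner_axis mult.commute mult_commute_abs)

text \<open>\<open>{0..T}\<close> is convex, and it contains \<open>0\<close> as soon as it contains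
  \<open>t\<close>.\<close>

lemma derivative_zero_on_interval:
  fixes f :: "real \<Rightarrow> real"
  assumes "\<And>t. t \<in> {0..T} \<Longrightarrow> (f has_real_derivative 0) (at t within {0..T})"
    and "t \<in> {0..T}"
  shows "f t = f 0"
  using has_field_derivative_zero_constant[of "{0..T}" f] assms by fastforce

lemma Lambda_mat_mult:
  "Lambda_mat s a *v x = vector
    [s * x $ 1, inverse s * x $ 2, cos a * x $ 3 + sin a * x $ 4, - sin a * x $ 3 + cos a * x $ 4]"
  by (simp add: vec_eq_iff forall_4 matrix_vector_mult_def Lambda_mat_def vector_4 sum_4)

text \<open>Along each \<open>axis i 1\<close> the Hamiltonian is a polynomial in \<open>s\<close>,
  so every partial derivative genuinely exists and \<open>deriv\<close> never takes a junk
  value.\<close>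

lemma hamiltonian_field_eff_hamiltonian:
  "hamiltonian_field (eff_hamiltonian lam nu) x =
    vector [lam * x $ 1, - lam * x $ 2, nu * x $ 4, - nu * x $ 3]"
proof -
  have "partial_deriv (eff_hamiltonian lam nu) 1 x = lam * x $ 2"
    unfolding partial_deriv_def eff_hamiltonian_def
    by (rule DERIV_imp_deriv) (auto intro!: derivative_eq_intros simp: axis_def)
  moreover have "partial_deriv (eff_hamiltonian lam nu) 2 x = lam * x $ 1"
    unfolding partial_deriv_def eff_hamiltonian_def
    by (rule DERIV_imp_deriv) (auto intro!: derivative_eq_intros simp: axis_def)
  moreover have "partial_deriv (eff_hamiltonian lam nu) 3 x = nu * x $ 3"
    unfolding partial_deriv_def eff_hamiltonian_def
    by (rule DERIV_imp_deriv) (auto intro!: derivative_eq_intros simp: axis_def)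
  moreover have "partial_deriv (eff_hamiltonian lam nu) 4 x = nu * x $ 4"
    unfolding partial_deriv_def eff_hamiltonian_def
    by (rule DERIV_imp_deriv) (auto intro!: derivative_eq_intros simp: axis_def)
  ultimately show ?thesis
    by (simp add: hamiltonian_field_def)
qed

lemma solves_hamilton_eff_hamiltonian_iff:
  "solves_hamilton (eff_hamiltonian lam nu) T x \<longleftrightarrow> (\<forall>t\<in>{0..T}.
    ((\<lambda>s. x s $ 1) has_real_derivative lam * x t $ 1) (at t within {0..T}) \<and>
    ((\<lambda>s. x s $ 2) has_real_derivative - lam * x t $ 2) (at t within {0..T}) \<and>
    ((\<lambda>s. x s $ 3) has_real_derivative nu * x t $ 4) (at t within {0..T}) \<and>
    ((\<lambda>s. x s $ 4) has_real_derivative - nu * x t $ 3) (at t within {0..T}))"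
  by (simp add: solves_hamilton_def hamiltonian_field_eff_hamiltonian
      has_vector_derivative_vec_iff forall_4 vector_4)

lemma solves_hamilton_flow:
  "solves_hamilton (eff_hamiltonian lam nu) T (\<lambda>t. Lambda_mat (exp (lam * t)) (nu * t) *v x)"
  \<comment> \<open>Rewriting \<open>inverse (exp (lam * t))\<close> as
    \<open>exp (- (lam * t))\<close> spares differentiating a reciprocal.\<close>
  unfolding solves_hamilton_eff_hamiltonian_iff Lambda_mat_mult vector_4 exp_minus[symmetric]
  by (auto intro!: derivative_eq_intros simp: algebra_simps)

text \<open>The integrating factor \<open>exp (- c * t)\<close> makes the product with
  \<open>f\<close> constant. The sign of \<open>c\<close> is free, so both \<open>lam\<close> and
  \<open>- lam\<close> are covered.\<close>

lemma linear_ode_zero: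
  fixes f :: "real \<Rightarrow> real"
  assumes "\<And>t. t \<in> {0..T} \<Longrightarrow> (f has_real_derivative c * f t) (at t within {0..T})"
    and "f 0 = 0" and "t \<in> {0..T}"
  shows "f t = 0"
proof -
  have "exp (- c * t) * f t = exp (- c * 0) * f 0"
    by (rule derivative_zero_on_interval[where T = T])
      (use assms(3) in \<open>auto intro!: derivative_eq_intros assms simp: assms\<close>)
  then show ?thesis
    using assms(2) by simp
qed

text \<open>The cross terms \<open>2 * c * f t * g t\<close> cancel in the derivative of the sum of
  squares, and a zero sum of squares forces both terms to vanish.\<close>

lemma oscillator_ode_zero:
  fixes f g :: "real \<Rightarrow> real"
  assumes "\<And>t. t \<in> {0..T} \<Longrightarrow> (f has_real_derivative c * g t) (at t within {0..T})"
    and "\<And>t. t \<in> {0..T} \<Longrightarrow> (g has_real_derivative - c * f t) (at t within {0..T})"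
    and "f 0 = 0" and "g 0 = 0" and "t \<in> {0..T}"
  shows "f t = 0" and "g t = 0"
proof -
  have "(f t)\<^sup>2 + (g t)\<^sup>2 = (f 0)\<^sup>2 + (g 0)\<^sup>2"
    by (rule derivative_zero_on_interval[where T = T])
      (use assms(5) in \<open>auto intro!: derivative_eq_intros assms simp: assms\<close>)
  then show "f t = 0" and "g t = 0"
    using assms(3,4) by (simp_all add: sum_power2_eq_zero_iff)
qed

text \<open>A quadratic Hamiltonian generates a linear field.\<close>

lemma solves_hamilton_eff_hamiltonian_diff:
  assumes "solves_hamilton (eff_hamiltonian lam nu) T x"
    and "solves_hamilton (eff_hamiltonian lam nu) T y"
  shows "solves_hamilton (eff_hamiltonian lam nu) T (\<lambda>t. y t - x t)"
  using assms unfolding solves_hamilton_eff_hamiltonian_iff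
  by (auto intro!: derivative_eq_intros simp: algebra_simps)

lemma solves_hamilton_eff_hamiltonian_unique:
  assumes "solves_hamilton (eff_hamiltonian lam nu) T x"
    and "solves_hamilton (eff_hamiltonian lam nu) T y"
    and "x 0 = y 0" and "t \<in> {0..T}"
  shows "y t = x t"
proof -
  define w where "w t = y t - x t" for t
  have w: "solves_hamilton (eff_hamiltonian lam nu) T w" and w0: "w 0 = 0"
    using solves_hamilton_eff_hamiltonian_diff[OF assms(1,2)] assms(3)
    by (simp_all add: w_def[abs_def])
  note ode = w[unfolded solves_hamilton_eff_hamiltonian_iff]
  have "w t $ 1 = 0"
    by (rule linear_ode_zero[of T "\<lambda>t. w t $ 1" lam]) (use ode w0 assms(4) in auto)
  moreover have "w t $ 2 = 0"
    by (rule linear_ode_zero[of T "\<lambda>t. w t $ 2" "- lam"]) (use ode w0 assms(4) in auto)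
  moreover have "w t $ 3 = 0"
    by (rule oscillator_ode_zero(1)[of T "\<lambda>t. w t $ 3" nu "\<lambda>t. w t $ 4"])
      (use ode w0 assms(4) in auto)
  moreover have "w t $ 4 = 0"
    by (rule oscillator_ode_zero(2)[of T "\<lambda>t. w t $ 3" nu "\<lambda>t. w t $ 4"])
      (use ode w0 assms(4) in auto)
  ultimately have "w t = 0"
    by (simp add: vec_eq_iff forall_4)
  then show ?thesis
    by (simp add: w_def)
qed

theorem proposition1:
  fixes T \<sigma> \<psi> lam nu :: real
  assumes "T > 0" and "\<sigma> > 1" and "\<psi> > 0"
    and "lam = (1 / T) * ln \<sigma>" and "nu = (1 / T) * \<psi>"
  shows "lam > 0 \<and> nu > 0 \<and>
    is_time_map (eff_hamiltonian lam nu) T (\<lambda>x. Lambda_mat \<sigma> \<psi> *v x)"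
proof (intro conjI)
  show "lam > 0" and "nu > 0"
    using assms by simp_all
  show "is_time_map (eff_hamiltonian lam nu) T (\<lambda>x. Lambda_mat \<sigma> \<psi> *v x)"
    unfolding is_time_map_def
  proof
    fix x\<^sub>0 :: "real ^ 4"
    let ?x = "\<lambda>t. Lambda_mat (exp (lam * t)) (nu * t) *v x\<^sub>0"
    have "?x 0 = x\<^sub>0"
      by (simp add: Lambda_mat_mult vec_eq_iff forall_4 vector_4)
    \<comment> \<open>Here \<open>lam * T = ln \<sigma>\<close> and \<open>nu * T = \<psi>\<close>
      since \<open>T\<close> is nonzero, and \<open>exp (ln \<sigma>) = \<sigma>\<close> since
      \<open>\<sigma>\<close> is positive.\<close>
    moreover have "?x T = Lambda_mat \<sigma> \<psi> *v x\<^sub>0"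
      using assms by simp
    ultimately show "\<exists>x. solves_hamilton (eff_hamiltonian lam nu) T x \<and> x 0 = x\<^sub>0 \<and>
        x T = Lambda_mat \<sigma> \<psi> *v x\<^sub>0 \<and>
        (\<forall>y. solves_hamilton (eff_hamiltonian lam nu) T y \<and> y 0 = x\<^sub>0 \<longrightarrow>
          (\<forall>t\<in>{0..T}. y t = x t))"
      using solves_hamilton_flow[of lam nu T x\<^sub>0]
        solves_hamilton_eff_hamiltonian_unique[of lam nu T ?x]
      by (intro exI[of _ ?x]) auto
  qed
qed

end
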